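(* For any simplicial graph $G$ with simplicial clique $K$, the independence polynomial $I(G)$ divides the relative independence polynomial $I(T^{\boxtimes}_K(G))=I^{\phi_K}(T^{\boxtimes}_K(G))$ of the simplicial clique tree of $G$ with respect to $K$.
   Context: All graphs are finite, simple and undirected. A graph is claw-free if it has no induced $K_{1,3}$. A clique $K$ (set of pairwise adjacent vertices) in $G$ is a simplicial clique if for every $u\in K$ the set $N[u]\cap(G\setminus K)$, i.e. the set of neighbors of $u$ outside $K$, is a clique. A graph is simplicial if it is claw-free and contains a simplicial clique. The multivariate independence polynomial is $I(G)(\mathbf{x})=\sum_{S\subseteq V,\ S\text{ independent}}\prod_{v\in S}x_v$. Given a graph homomorphism $\phi:H\to G$, the relative independence polynomial of $H$ is $I^{\phi}(H)(\mathbf{x})=\sum_{S\subseteq V(H),\ S\text{ independent}}\prod_{v\in S}x_{\phi(v)}$, in variables indexed by $V(G)$. Simplicial clique tree: for $G$ simplicial with simplicial clique $K$, $T^{\boxtimes}_K(G)$ is defined recursively. If $G=K$, then $T^{\boxtimes}_K(G)=G$ with root clique $K$, each vertex labeled by itself. For arbitrary $G$, for $u\in K$ let $J_u:=N[u]\cap(G\setminus K)$; it is known that, $G$ being claw-free, $J_u$ is a simplicial clique of $G\setminus K$. Take the disjoint union of the labeled graphs $T^{\boxtimes}_{J_u}(G\setminus K)$ over all $u\in K$, add a copy of the clique $K$ (the root clique, each vertex labeled by itself), and join each $u\in K$ to every vertex of the root clique of $T^{\boxtimes}_{J_u}(G\setminus K)$. The labels define a graph homomorphism $\phi_K:T^{\boxtimes}_K(G)\to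 G$.
   Formalization: The formal theorem also assumes that G is connected and K is nonempty; without this the claim fails: for two isolated vertices a, b and K = {a}, the simplicial clique tree is the single vertex a, and (1+x_a)(1+x_b) does not divide 1+x_a. *)

theory Defs
  imports "HOL-Library.Poly_Mapping" "Graph_Theory.Graph_Theory"
begin

text \<open>
  A finite simple undirected graph is a \<open>pair_graph\<close>: a finite loop-free \<open>pair_pre_digraph\<close>
  whose arc relation is symmetric.
\<close>

definition nbrs :: "'v pair_pre_digraph \<Rightarrow> 'v \<Rightarrow> 'v set" where
  "nbrs G u = {v. (u, v) \<in> parcs G}"

definition del_verts :: "'v pair_pre_digraph \<Rightarrow> 'v set \<Rightarrow> 'v pair_pre_digraph" where
  "del_verts G S = \<lparr>pverts = pverts G - S, parcs = {(u, v) \<in> parcs G. u \<notin> S \<and> v \<notin> S}\<rparr>"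

lemma with_proj_del_verts:
  assumes "pair_wf_digraph G"
  shows "with_proj (del_verts G S) = with_proj G \<restriction> (pverts G - S)"
  using pair_wf_digraph.in_arcsD1[OF assms] pair_wf_digraph.in_arcsD2[OF assms]
  by (auto simp: del_verts_def with_proj_def induce_subgraph_def)

definition clique :: "'v pair_pre_digraph \<Rightarrow> 'v set \<Rightarrow> bool" where
  "clique G K \<longleftrightarrow> K \<subseteq> pverts G \<and> (\<forall>u\<in>K. \<forall>v\<in>K. u \<noteq> v \<longrightarrow> (u, v) \<in> parcs G)"

definition independent_set :: "'v pair_pre_digraph \<Rightarrow> 'v set \<Rightarrow> bool" where
  "independent_set G S \<longleftrightarrow> S \<subseteq> pverts G \<and> (\<forall>u\<in>S. \<forall>v\<in>S. (u, v) \<notin> parcs G)"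

definition claw_free :: "'v pair_pre_digraph \<Rightarrow> bool" where
  "claw_free G \<longleftrightarrow>
    (\<nexists>H. induced_subgraph H (with_proj G) \<and> complete_bipartite_digraph 1 3 H)"

text \<open>
  The set \<open>J\<^sub>u = N[u] \<inter> (G - K)\<close>.
\<close>

definition outer_nbrs :: "'v pair_pre_digraph \<Rightarrow> 'v set \<Rightarrow> 'v \<Rightarrow> 'v set" where
  "outer_nbrs G K u = insert u (nbrs G u) \<inter> (pverts G - K)"

text \<open>
  The empty set counts as a simplicial clique here: \<open>J\<^sub>u\<close> is a simplicial clique of \<open>G - K\<close> also
  when it is empty.  It does not count as a witness for a graph being simplicial, which would
  make every claw-free graph simplicial.
\<close>

definition simplicial_clique :: "'v pair_pre_digraph \<Rightarrow> 'v set \<Rightarrow> bool" where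
  "simplicial_clique G K \<longleftrightarrow> clique G K \<and> (\<forall>u\<in>K. clique G (outer_nbrs G K u))"

definition simplicial_graph :: "'v pair_pre_digraph \<Rightarrow> bool" where
  "simplicial_graph G \<longleftrightarrow> claw_free G \<and> (\<exists>K. K \<noteq> {} \<and> simplicial_clique G K)"

definition graph_hom ::
  "('w \<Rightarrow> 'v) \<Rightarrow> 'w pair_pre_digraph \<Rightarrow> 'v pair_pre_digraph \<Rightarrow> bool" where
  "graph_hom \<phi> H G \<longleftrightarrow>
    \<phi> ` pverts H \<subseteq> pverts G \<and> (\<forall>(u, v) \<in> parcs H. (\<phi> u, \<phi> v) \<in> parcs G)"


text \<open>
  Polynomials over \<open>'r\<close> in commuting variables indexed by \<open>'v\<close> form the type
  \<open>('v \<Rightarrow>\<^sub>0 nat) \<Rightarrow>\<^sub>0 'r\<close>, with the inner finitely supported functions as exponent vectors.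
\<close>

type_synonym ('v, 'r) mpolynomial = "('v \<Rightarrow>\<^sub>0 nat) \<Rightarrow>\<^sub>0 'r"

definition pvar :: "'v \<Rightarrow> ('v, 'r::comm_ring_1) mpolynomial" where
  "pvar v = Poly_Mapping.single (Poly_Mapping.single v 1) 1"

definition rel_indep_poly ::
  "('w \<Rightarrow> 'v) \<Rightarrow> 'w pair_pre_digraph \<Rightarrow> ('v, 'r::comm_ring_1) mpolynomial" where
  "rel_indep_poly \<phi> H = (\<Sum>S | independent_set H S. \<Prod>v\<in>S. pvar (\<phi> v))"

definition indep_poly :: "'v pair_pre_digraph \<Rightarrow> ('v, 'r::comm_ring_1) mpolynomial" where
  "indep_poly G = (\<Sum>S | independent_set G S. \<Prod>v\<in>S. pvar v)"


text \<open>
  The vertices of the simplicial clique tree are nonempty lists: the root clique consists of the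
  lists \<open>[u]\<close> for \<open>u \<in> K\<close>, and prefixing with \<open>u\<close> makes the disjoint copy, for \<open>u \<in> K\<close>, of the
  tree of \<open>G - K\<close> with respect to \<open>J\<^sub>u\<close>.  Thus the label of a vertex is the last entry of the
  list: \<open>[u]\<close> has label \<open>u\<close>, and \<open>u # p\<close> has the label of \<open>p\<close>.

  The tree for an empty \<open>J\<^sub>u\<close> is the empty graph, as the recursive clause prescribes.
  Hence only components of \<open>G\<close> meeting \<open>K\<close> contribute to the tree, so divisibility can only
  be expected for connected \<open>G\<close> and nonempty \<open>K\<close>: for two isolated vertices and \<open>K = {a}\<close>,
  the tree is the single vertex \<open>[a]\<close>, and \<open>(1 + x\<^sub>a)(1 + x\<^sub>b)\<close> does not divide \<open>1 + x\<^sub>a\<close>.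
  The value outside finite \<open>G\<close> and \<open>K \<subseteq> pverts G\<close> is irrelevant.
\<close>

abbreviation clique_tree_label :: "'v list \<Rightarrow> 'v" where
  "clique_tree_label \<equiv> last"

definition root_clique :: "'v set \<Rightarrow> 'v list set" where
  "root_clique K = (\<lambda>u. [u]) ` K"

function clique_tree :: "'v pair_pre_digraph \<Rightarrow> 'v set \<Rightarrow> 'v list pair_pre_digraph" where
  "clique_tree G K =
    (if pverts G = K then
       \<lparr>pverts = root_clique K, parcs = {([u], [v]) | u v. (u, v) \<in> parcs G}\<rparr>
     else if finite (pverts G) \<and> K \<subseteq> pverts G then
       \<lparr>pverts = root_clique K \<union>
          (\<Union>u\<in>K. (#) u ` pverts (clique_tree (del_verts G K) (outer_nbrs G K u))),
        parcs = {([u], [v]) | u v. u \<in> K \<and> v \<in> K \<and> u \<noteq> v} \<union>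
          (\<Union>u\<in>K. {(u # p, u # q) | p q.
             (p, q) \<in> parcs (clique_tree (del_verts G K) (outer_nbrs G K u))}) \<union>
          (\<Union>u\<in>K. \<Union>r \<in> root_clique (outer_nbrs G K u). {([u], u # r), (u # r, [u])})\<rparr>
     else \<lparr>pverts = {}, parcs = {}\<rparr>)"
  by pat_completeness auto

termination
proof -
  have less: "card (pverts (del_verts G K)) < card (pverts G)"
    if "finite (pverts G)" "K \<subseteq> pverts G" "u \<in> K" for G :: "'v pair_pre_digraph" and K u
    using that by (auto simp: del_verts_def intro!: psubset_card_mono)
  show ?thesis
    by (relation "Wellfounded.measure (\<lambda>(G, K). card (pverts G))") (auto intro: less)
qed

declare clique_tree.simps [simp del]

text \<open>
  The sets \<open>J\<^sub>u\<close> are simplicial cliques of \<open>G - K\<close>, the tree is a finite simple graph, and its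
  labels define a homomorphism to \<open>G\<close>.
\<close>

lemma pair_graph_iff:
  "pair_graph G \<longleftrightarrow> finite (pverts G) \<and> parcs G \<subseteq> pverts G \<times> pverts G \<and>
    (\<forall>u v. (u, v) \<in> parcs G \<longrightarrow> u \<noteq> v \<and> (v, u) \<in> parcs G)"
proof
  assume "pair_graph G"
  then interpret pair_graph G .
  show "finite (pverts G) \<and> parcs G \<subseteq> pverts G \<times> pverts G \<and>
    (\<forall>u v. (u, v) \<in> parcs G \<longrightarrow> u \<noteq> v \<and> (v, u) \<in> parcs G)"
    using pair_finite_verts in_arcsD1 in_arcsD2 pair_no_loops arcs_symmetric by force
next
  assume *: "finite (pverts G) \<and> parcs G \<subseteq> pverts G \<times> pverts G \<and>
    (\<forall>u v. (u, v) \<in> parcs G \<longrightarrow> u \<noteq> v \<and> (v, u) \<in> parcs G)"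
  then have "finite (parcs G)"
    by (meson finite_SigmaI finite_subset)
  with * show "pair_graph G"
    by unfold_locales (auto simp: symmetric_def sym_def)
qed

lemma pair_graph_del_verts: "pair_graph G \<Longrightarrow> pair_graph (del_verts G S)"
  by (auto simp: pair_graph_iff del_verts_def)

lemma claw_freeD:
  assumes G: "pair_graph G" and "claw_free G"
    and arcs: "(c, x) \<in> parcs G" "(c, y) \<in> parcs G" "(c, z) \<in> parcs G"
    and "x \<noteq> y" "x \<noteq> z" "y \<noteq> z"
  shows "(x, y) \<in> parcs G \<or> (x, z) \<in> parcs G \<or> (y, z) \<in> parcs G"
proof (rule ccontr)
  assume no: "\<not> ?thesis"
  interpret G: pair_graph G by fact
  have sym: "(u, v) \<in> parcs G \<Longrightarrow> (v, u) \<in> parcs G"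
    and irr: "(u, u) \<notin> parcs G" for u v
    using G by (auto simp: pair_graph_iff)
  define H where "H = with_proj G \<restriction> {c, x, y, z}"
  have W: "{c, x, y, z} \<subseteq> pverts G"
    using arcs G.in_arcsD1 G.in_arcsD2 by auto
  have ind: "induced_subgraph H (with_proj G)"
    unfolding H_def using W by (intro G.induced_induce) auto
  have "graph H"
  proof -
    interpret D: digraph H using ind by (rule G.digraphI_induced)
    interpret S: sym_digraph H using ind by (rule G.induced_graph_imp_graph)
    show ?thesis by unfold_locales
  qed
  moreover have "arcs_ends H = {c} \<times> {x, y, z} \<union> {x, y, z} \<times> {c}"
  proof -
    have "(x, c) \<in> parcs G" "(y, c) \<in> parcs G" "(z, c) \<in> parcs G"
      "(y, x) \<notin> parcs G" "(z, x) \<notin> parcs G" "(z, y) \<notin> parcs G"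
      using arcs no by (blast intro: sym)+
    moreover have "arcs_ends H = {(a, b) \<in> parcs G. a \<in> {c, x, y, z} \<and> b \<in> {c, x, y, z}}"
      unfolding H_def by (auto simp: arcs_ends_conv)
    ultimately show ?thesis using arcs no irr by auto
  qed
  moreover have "card {c} = 1" "card {x, y, z} = 3" "{c} \<inter> {x, y, z} = {}"
    using arcs irr assms(6-8) by auto
  moreover have "verts H = {c} \<union> {x, y, z}" by (auto simp: H_def)
  ultimately have "complete_bipartite_digraph 1 3 H"
    unfolding complete_bipartite_digraph_def by (intro conjI exI[of _ "{c}"] exI[of _ "{x, y, z}"])
  with ind \<open>claw_free G\<close> show False by (auto simp: claw_free_def)
qed

lemma claw_free_del_verts:
  assumes "pair_graph G" "claw_free G"
  shows "claw_free (del_verts G S)"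
proof -
  interpret G: pair_graph G by fact
  have "induced_subgraph (with_proj (del_verts G S)) (with_proj G)"
    unfolding with_proj_del_verts[OF G.pair_wf_digraph] by (intro G.induced_induce) auto
  then have "induced_subgraph H (with_proj G)"
    if "induced_subgraph H (with_proj (del_verts G S))" for H
    using that unfolding induced_subgraph_def
    by (auto simp: del_verts_def subgraph_def compatible_def)
  with \<open>claw_free G\<close> show ?thesis
    by (auto simp: claw_free_def)
qed

lemma simplicial_clique_outer_nbrs:
  assumes G: "pair_graph G" "claw_free G" and K: "simplicial_clique G K" "u \<in> K"
  shows "simplicial_clique (del_verts G K) (outer_nbrs G K u)"
proof -
  let ?H = "del_verts G K" and ?J = "outer_nbrs G K u"
  have sym: "(a, b) \<in> parcs G \<Longrightarrow> (b, a) \<in> parcs G"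
    and wf: "(a, b) \<in> parcs G \<Longrightarrow> a \<in> pverts G \<and> b \<in> pverts G" for a b
    using G by (auto simp: pair_graph_iff)
  have u: "u \<in> pverts G" using K by (auto simp: simplicial_clique_def clique_def)
  have "clique ?H ?J"
    using K by (auto simp: simplicial_clique_def clique_def outer_nbrs_def del_verts_def)
  moreover have "clique ?H (outer_nbrs ?H ?J w)" if w: "w \<in> ?J" for w
  proof -
    have "(a, b) \<in> parcs ?H"
      if "a \<in> outer_nbrs ?H ?J w" "b \<in> outer_nbrs ?H ?J w" "a \<noteq> b" for a b
    proof -
      have wu: "(w, u) \<in> parcs G" using w K(2) sym by (auto simp: outer_nbrs_def nbrs_def)
      have ab: "(w, a) \<in> parcs G" "(w, b) \<in> parcs G" "a \<notin> K" "b \<notin> K"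
        "(u, a) \<notin> parcs G" "(u, b) \<notin> parcs G"
        using that w by (auto simp: outer_nbrs_def nbrs_def del_verts_def)
      then have "(a, b) \<in> parcs G"
        using claw_freeD[OF G wu, of a b] that K(2) by auto
      with ab show ?thesis by (auto simp: del_verts_def)
    qed
    then show ?thesis by (auto simp: clique_def outer_nbrs_def)
  qed
  ultimately show ?thesis by (auto simp: simplicial_clique_def)
qed

lemma clique_tree_self: "pverts G = K \<Longrightarrow> clique_tree G K =
    \<lparr>pverts = root_clique K, parcs = {([u], [v]) | u v. (u, v) \<in> parcs G}\<rparr>"
  by (subst clique_tree.simps) simp

lemma clique_tree_step:
  assumes "pverts G \<noteq> K" "finite (pverts G)" "K \<subseteq> pverts G"
  defines "T \<equiv> \<lambda>u. clique_tree (del_verts G K) (outer_nbrs G K u)"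
  shows "pverts (clique_tree G K) = root_clique K \<union> (\<Union>u\<in>K. (#) u ` pverts (T u))"
    and "parcs (clique_tree G K) = {([u], [v]) | u v. u \<in> K \<and> v \<in> K \<and> u \<noteq> v} \<union>
      (\<Union>u\<in>K. {(u # p, u # q) | p q. (p, q) \<in> parcs (T u)}) \<union>
      (\<Union>u\<in>K. \<Union>r \<in> root_clique (outer_nbrs G K u). {([u], u # r), (u # r, [u])})"
  unfolding T_def using assms(1-3) by (subst clique_tree.simps; simp)+

lemma root_clique_subset:
  assumes "finite (pverts G)" "K \<subseteq> pverts G"
  shows "root_clique K \<subseteq> pverts (clique_tree G K)"
  using assms by (subst clique_tree.simps) auto

lemma outer_nbrs_subset: "outer_nbrs G K u \<subseteq> pverts (del_verts G K)"
  by (auto simp: outer_nbrs_def del_verts_def)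

lemma clique_tree_wf:
  assumes "pair_graph G" "K \<subseteq> pverts G"
  shows "pair_graph (clique_tree G K) \<and> [] \<notin> pverts (clique_tree G K)"
  using assms
proof (induction G K rule: clique_tree.induct)
  case (1 G K)
  show ?case
  proof (cases "pverts G = K")
    case True
    with 1(3) show ?thesis
      by (auto simp: pair_graph_iff root_clique_def clique_tree_self)
  next
    case False
    define T where "T u = clique_tree (del_verts G K) (outer_nbrs G K u)" for u
    have fin: "finite (pverts G)" using 1(3) by (simp add: pair_graph_iff)
    then have finK: "finite K" using 1(4) finite_subset by auto
    have T: "pair_graph (T u)" "[] \<notin> pverts (T u)" if "u \<in> K" for u
      unfolding T_def
      using 1(1)[OF False conjI[OF fin 1(4)] that pair_graph_del_verts[OF 1(3)] outer_nbrs_subset]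
      by simp_all
    have root: "root_clique (outer_nbrs G K u) \<subseteq> pverts (T u)" for u
      unfolding T_def using fin
      by (intro root_clique_subset outer_nbrs_subset) (simp add: del_verts_def)
    have ne: "r \<noteq> []" if "r \<in> root_clique L" for r and L :: "'a set"
      using that by (auto simp: root_clique_def)
    note step = clique_tree_step[OF False fin 1(4), folded T_def]
    have "a \<in> pverts (clique_tree G K) \<and> b \<in> pverts (clique_tree G K) \<and> a \<noteq> b \<and>
        (b, a) \<in> parcs (clique_tree G K)"
      if ab: "(a, b) \<in> parcs (clique_tree G K)" for a b
    proof -
      consider u v where "a = [u]" "b = [v]" "u \<in> K" "v \<in> K" "u \<noteq> v"
        | u p q where "u \<in> K" "a = u # p" "b = u # q" "(p, q) \<in> parcs (T u)"
        | u r where "u \<in> K" "r \<in> root_clique (outer_nbrs G K u)"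
            "a = [u] \<and> b = u # r \<or> a = u # r \<and> b = [u]"
        using ab unfolding step by blast
      then show ?thesis
      proof cases
        case 1
        then show ?thesis unfolding step root_clique_def by blast
      next
        case 2
        then have "p \<in> pverts (T u)" "q \<in> pverts (T u)" "p \<noteq> q" "(q, p) \<in> parcs (T u)"
          using T by (auto simp: pair_graph_iff)
        with 2 show ?thesis unfolding step by blast
      next
        case 3
        then have "r \<in> pverts (T u)" "r \<noteq> []" "[u] \<in> root_clique K"
          using root ne by (auto simp: root_clique_def)
        with 3 show ?thesis unfolding step by blast
      qed
    qed
    moreover have "finite (pverts (clique_tree G K))"
      using finK T(1) by (auto simp: step root_clique_def pair_graph_iff)
    moreover have "[] \<notin> pverts (clique_tree G K)"
      by (auto simp: step root_clique_def)
    ultimately show ?thesis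
      unfolding pair_graph_iff by auto
  qed
qed

lemma graph_hom_clique_tree_label:
  assumes "pair_graph G" "claw_free G" "simplicial_clique G K"
  shows "graph_hom clique_tree_label (clique_tree G K) G"
  using assms
proof (induction G K rule: clique_tree.induct)
  case (1 G K)
  show ?case
  proof (cases "pverts G = K")
    case True
    then show ?thesis
      by (auto simp: graph_hom_def root_clique_def clique_tree_self)
  next
    case False
    define T where "T u = clique_tree (del_verts G K) (outer_nbrs G K u)" for u
    have fin: "finite (pverts G)" and symG: "(a, b) \<in> parcs G \<Longrightarrow> (b, a) \<in> parcs G" for a b
      using 1(3) by (auto simp: pair_graph_iff)
    have K: "K \<subseteq> pverts G"
      and KK: "a \<in> K \<Longrightarrow> b \<in> K \<Longrightarrow> a \<noteq> b \<Longrightarrow> (a, b) \<in> parcs G" for a b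
      using 1(5) by (auto simp: simplicial_clique_def clique_def)
    have wf: "pair_graph (T u)" "[] \<notin> pverts (T u)" for u
      using clique_tree_wf[OF pair_graph_del_verts[OF 1(3)] outer_nbrs_subset]
      by (auto simp: T_def)
    have hom: "graph_hom last (T u) (del_verts G K)" if "u \<in> K" for u
      unfolding T_def using False fin K that 1(3-5)
      by (intro 1(1)) (auto intro: pair_graph_del_verts claw_free_del_verts
          simplicial_clique_outer_nbrs)
    have verts: "last (u # p) \<in> pverts G" if "u \<in> K" "p \<in> pverts (T u)" for u p
    proof -
      have "p \<noteq> []" using wf(2)[of u] that by auto
      then show ?thesis using hom[OF that(1)] that(2)
        by (auto simp: graph_hom_def del_verts_def)
    qed
    have arcs: "(last (u # p), last (u # q)) \<in> parcs G"
      if "u \<in> K" "(p, q) \<in> parcs (T u)" for u p q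
    proof -
      have "p \<noteq> []" "q \<noteq> []" using wf[of u] that by (auto simp: pair_graph_iff)
      then show ?thesis using hom[OF that(1)] that(2)
        by (auto simp: graph_hom_def del_verts_def)
    qed
    have join: "(u, w) \<in> parcs G" if "u \<in> K" "w \<in> outer_nbrs G K u" for u w
      using that by (auto simp: outer_nbrs_def nbrs_def)
    note step = clique_tree_step[OF False fin K, folded T_def]
    have "last p \<in> pverts G" if "p \<in> pverts (clique_tree G K)" for p
      using that K verts by (auto simp: step root_clique_def simp del: last.simps simp: last_ConsL)
    moreover have "(last p, last q) \<in> parcs G" if "(p, q) \<in> parcs (clique_tree G K)" for p q
      using that unfolding step
    proof (elim UnE)
      assume "(p, q) \<in> (\<Union>u\<in>K. {(u # p, u # q) | p q. (p, q) \<in> parcs (T u)})"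
      then show ?thesis using arcs by blast
    qed (use KK join symG in \<open>auto simp: root_clique_def\<close>)
    ultimately show ?thesis by (auto simp: graph_hom_def)
  qed
qed

end

theory Submission
  imports Defs
begin

text \<open>
  Write \<open>T\<close> for the tree, \<open>T\<^sub>u\<close> for the subtree over \<open>G - K\<close> with root clique \<open>J\<^sub>u\<close>, and let
  \<open>T - K\<close> and \<open>T\<^sub>u - J\<^sub>u\<close> denote the trees without their root cliques.  An independent set contains
  at most one vertex of \<open>K\<close>, so \<open>I(G) = I(G - K) + (\<Sum>u\<in>K. x\<^sub>u I(G - K - J\<^sub>u))\<close>, and likewise
  \<open>I(T) / I(T - K) = 1 + (\<Sum>u\<in>K. x\<^sub>u I(T\<^sub>u - J\<^sub>u) / I(T\<^sub>u))\<close> with \<open>I(T - K) = (\<Prod>u\<in>K. I(T\<^sub>u))\<close>.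
  By induction \<open>I(T) I(G - K) = I(T - K) I(G)\<close>.

  Divisibility is proved by a second induction, for the part of \<open>G\<close> reachable from \<open>K\<close>, since
  \<open>G - K\<close> may be disconnected.  Each component of \<open>G - K\<close> reachable from \<open>K\<close> is the one
  meeting some \<open>J\<^sub>u\<close>, and its polynomial divides \<open>I(T\<^sub>u)\<close>; distinct components use distinct \<open>u\<close>, so
  the product over these components divides \<open>I(T - K)\<close>.  Polynomials with constant term 1 are
  cancellable over any commutative ring, and the identity above gives the claim.
\<close>

section \<open>Weighted sums over independent sets\<close>

text \<open>Arcs, weights and vertex set are separate arguments, so deleting vertices changes only
  \<open>S\<close> while \<open>E\<close> stays fixed. Weights \<open>pvar\<close> give
  \<open>I(G)\<close>, and weights \<open>pvar\<close> composed with the label map give the relative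
  polynomial of the tree.\<close>

definition indep_sum :: "('a \<times> 'a) set \<Rightarrow> ('a \<Rightarrow> 'b::comm_semiring_1) \<Rightarrow> 'a set \<Rightarrow> 'b" where
  "indep_sum E f S = (\<Sum>X | X \<subseteq> S \<and> X \<times> X \<inter> E = {}. \<Prod>v\<in>X. f v)"

lemma indep_sum_empty [simp]: "indep_sum E f {} = 1"
proof -
  have "{X. X \<subseteq> {} \<and> X \<times> X \<inter> E = {}} = {{}}" by auto
  then show ?thesis by (simp add: indep_sum_def)
qed

lemma indep_sum_cong:
  assumes "\<And>v. v \<in> S \<Longrightarrow> f v = g v" "E \<inter> S \<times> S = F \<inter> S \<times> S"
  shows "indep_sum E f S = indep_sum F g S"
  unfolding indep_sum_def
proof (rule sum.cong)
  show "{X. X \<subseteq> S \<and> X \<times> X \<inter> E = {}} = {X. X \<subseteq> S \<and> X \<times> X \<inter> F = {}}"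
    using assms(2) by blast
qed (use assms(1) in \<open>auto intro!: prod.cong\<close>)

text \<open>Serves to identify the copy of a subtree, embedded by prefixing a vertex, with the
  subtree itself.\<close>

lemma indep_sum_image:
  assumes "inj_on g S"
  shows "indep_sum E f (g ` S) = indep_sum {(u, v). (g u, g v) \<in> E} (f \<circ> g) S"
  unfolding indep_sum_def
proof -
  let ?A = "{X. X \<subseteq> S \<and> X \<times> X \<inter> {(u, v). (g u, g v) \<in> E} = {}}"
  have "inj_on ((`) g) ?A"
    using assms by (auto simp: inj_on_def inj_on_image_eq_iff)
  moreover have "(`) g ` ?A = {X. X \<subseteq> g ` S \<and> X \<times> X \<inter> E = {}}"
  proof (intro equalityI subsetI)
    fix Z assume Z: "Z \<in> {X. X \<subseteq> g ` S \<and> X \<times> X \<inter> E = {}}"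
    then obtain X where "X \<subseteq> S" "Z = g ` X" by (auto elim: subset_imageE)
    with Z have "X \<in> ?A" by blast
    with \<open>Z = g ` X\<close> show "Z \<in> (`) g ` ?A" by blast
  qed auto
  moreover have "(\<Prod>v\<in>g ` X. f v) = (\<Prod>v\<in>X. (f \<circ> g) v)" if "X \<in> ?A" for X
    using that assms inj_on_subset by (intro prod.reindex) blast
  ultimately show "(\<Sum>X | X \<subseteq> g ` S \<and> X \<times> X \<inter> E = {}. \<Prod>v\<in>X. f v) =
      (\<Sum>X\<in>?A. \<Prod>v\<in>X. (f \<circ> g) v)"
    by (intro sum.reindex_cong[of "(`) g"]) auto
qed

text \<open>An independent set either avoids \<open>u\<close> or arises by adding \<open>u\<close>
  to an independent set that avoids \<open>u\<close> and all its neighbours.\<close>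

lemma indep_sum_delete:
  assumes "finite S" "u \<in> S" "sym E" "irrefl E"
  shows "indep_sum E f S = indep_sum E f (S - {u}) + f u * indep_sum E f (S - {u} - E `` {u})"
proof -
  let ?A = "{X. X \<subseteq> S - {u} \<and> X \<times> X \<inter> E = {}}"
  let ?B = "{X. X \<subseteq> S - {u} - E `` {u} \<and> X \<times> X \<inter> E = {}}"
  have fin: "finite ?A" "finite ?B"
    using assms(1) by auto
  have "{X. X \<subseteq> S \<and> X \<times> X \<inter> E = {}} = ?A \<union> insert u ` ?B"
  proof (intro set_eqI iffI)
    fix X assume X: "X \<in> {X. X \<subseteq> S \<and> X \<times> X \<inter> E = {}}"
    show "X \<in> ?A \<union> insert u ` ?B"
    proof (cases "u \<in> X")
      case True
      then have "X = insert u (X - {u})" by auto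
      moreover have "X - {u} \<in> ?B" using X True by auto
      ultimately show ?thesis by blast
    qed (use X in auto)
  next
    fix X assume "X \<in> ?A \<union> insert u ` ?B"
    then show "X \<in> {X. X \<subseteq> S \<and> X \<times> X \<inter> E = {}}"
      using assms(2-4) by (auto simp: irrefl_def dest: symD)
  qed
  moreover have "?A \<inter> insert u ` ?B = {}" by auto
  moreover have "inj_on (insert u) ?B" by (auto simp: inj_on_def)
  moreover have "(\<Prod>v\<in>insert u X. f v) = f u * (\<Prod>v\<in>X. f v)" if "X \<in> ?B" for X
  proof -
    have "finite X" "u \<notin> X" using that assms(1) finite_subset by auto
    then show ?thesis by simp
  qed
  ultimately show ?thesis
    using fin by (simp add: indep_sum_def sum.union_disjoint sum.reindex sum_distrib_left)
qed

text \<open>Apply the deletion recurrence at some \<open>u\<close> in \<open>A\<close>. Since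
  \<open>u\<close> has no neighbour in \<open>B\<close>, both remaining vertex sets are again a
  smaller part of \<open>A\<close> together with all of \<open>B\<close>. The induction is over
  proper subsets because deleting the neighbours of \<open>u\<close> may remove many vertices at
  once.\<close>

lemma indep_sum_Un_disjoint:
  assumes "finite A" "finite B" "A \<inter> B = {}" "A \<times> B \<inter> E = {}" "sym E" "irrefl E"
  shows "indep_sum E f (A \<union> B) = indep_sum E f A * indep_sum E f B"
  using assms
proof (induction A rule: finite_psubset_induct)
  case (psubset A)
  show ?case
  proof (cases "A = {}")
    case False
    then obtain u where u: "u \<in> A" by auto
    let ?A1 = "A - {u}" and ?A2 = "A - {u} - E `` {u}"
    have "A \<union> B - {u} = ?A1 \<union> B" "A \<union> B - {u} - E `` {u} = ?A2 \<union> B"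
      using u psubset.prems by auto
    moreover have "indep_sum E f (?A1 \<union> B) = indep_sum E f ?A1 * indep_sum E f B"
      using u psubset.prems by (intro psubset.IH) auto
    moreover have "indep_sum E f (?A2 \<union> B) = indep_sum E f ?A2 * indep_sum E f B"
      using u psubset.prems by (intro psubset.IH) auto
    ultimately show ?thesis
      using indep_sum_delete[of "A \<union> B" u E f] indep_sum_delete[of A u E f] u psubset
      by (simp add: algebra_simps)
  qed simp
qed

lemma indep_sum_UN_disjoint:
  assumes "finite I" "\<And>i. i \<in> I \<Longrightarrow> finite (A i)" "sym E" "irrefl E"
    and "\<And>i j. i \<in> I \<Longrightarrow> j \<in> I \<Longrightarrow> i \<noteq> j \<Longrightarrow> A i \<inter> A j = {} \<and> A i \<times> A j \<inter> E = {}"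
  shows "indep_sum E f (\<Union>i\<in>I. A i) = (\<Prod>i\<in>I. indep_sum E f (A i))"
  using assms(1,2,5)
proof (induction I rule: finite_induct)
  case (insert i I)
  have "A i \<inter> (\<Union>i\<in>I. A i) = {}" "A i \<times> (\<Union>i\<in>I. A i) \<inter> E = {}"
    using insert.prems(2)[of i] insert.hyps by blast+
  then have "indep_sum E f (A i \<union> (\<Union>i\<in>I. A i)) = indep_sum E f (A i) * indep_sum E f (\<Union>i\<in>I. A i)"
    using insert assms(3,4) by (intro indep_sum_Un_disjoint) auto
  then show ?case using insert by simp
qed simp

text \<open>An independent set meets \<open>K\<close> in at most one vertex, and the summand at
  \<open>u\<close> collects the sets containing \<open>u\<close>. The proof deletes the vertices of
  \<open>K\<close> one at a time.\<close>

lemma indep_sum_clique: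
  assumes "finite S" "K \<subseteq> S" "sym E" "irrefl E"
    and "\<And>u v. u \<in> K \<Longrightarrow> v \<in> K \<Longrightarrow> u \<noteq> v \<Longrightarrow> (u, v) \<in> E"
  shows "indep_sum E f S = indep_sum E f (S - K) + (\<Sum>u\<in>K. f u * indep_sum E f (S - K - E `` {u}))"
proof -
  have "finite K" using assms(1,2) finite_subset by blast
  then show ?thesis using assms(2,5)
  proof (induction K rule: finite_induct)
    case (insert v K)
    have "indep_sum E f S = indep_sum E f (S - K) + (\<Sum>u\<in>K. f u * indep_sum E f (S - K - E `` {u}))"
      using insert.prems by (intro insert.IH) auto
    \<comment> \<open>The new vertex \<open>v\<close> is a neighbour of every earlier
      \<open>u\<close>, so it is already missing from these sets.\<close>
    also have "(\<Sum>u\<in>K. f u * indep_sum E f (S - K - E `` {u})) =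
        (\<Sum>u\<in>K. f u * indep_sum E f (S - insert v K - E `` {u}))"
    proof (rule sum.cong)
      fix u assume "u \<in> K"
      then have "(u, v) \<in> E" using insert by auto
      then have "S - K - E `` {u} = S - insert v K - E `` {u}" by auto
      then show "f u * indep_sum E f (S - K - E `` {u}) = f u * indep_sum E f (S - insert v K - E `` {u})"
        by simp
    qed simp
    also have "indep_sum E f (S - K) = indep_sum E f (S - insert v K)
        + f v * indep_sum E f (S - insert v K - E `` {v})"
      using indep_sum_delete[of "S - K" v E f] insert assms(1,3,4)
      by (simp add: set_diff_eq) (simp add: conj_commute Collect_conj_eq conj_left_commute)
    finally show ?case using insert.hyps by (simp add: algebra_simps)
  qed simp
qed

section \<open>Cancellation of polynomials with constant term 1\<close>

text \<open>If \<open>q\<close> were nonzero, take a monomial \<open>m\<close> of \<open>q\<close>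
  of least total degree. Its coefficient in \<open>p * q\<close> is the constant term of
  \<open>p\<close> times its coefficient in \<open>q\<close>, hence nonzero. The argument tolerates
  zero divisors among the coefficients.\<close>

lemma mpolynomial_const_1_cancel:
  fixes p q :: "('v, 'r::comm_ring_1) mpolynomial"
  assumes "Poly_Mapping.lookup p 0 = 1" "p * q = 0"
  shows "q = 0"
proof (rule ccontr)
  assume "q \<noteq> 0"
  define deg :: "('v \<Rightarrow>\<^sub>0 nat) \<Rightarrow> nat" where "deg m = (\<Sum>v\<in>Poly_Mapping.keys m. Poly_Mapping.lookup m v)" for m
  have deg_add: "deg (a + b) = deg a + deg b" for a b
    unfolding deg_def by (rule setsum_keys_plus_distrib) auto
  have deg_pos: "deg a > 0" if "a \<noteq> 0" for a
  proof -
    have "Poly_Mapping.keys a \<noteq> {}" using that by simp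
    then show ?thesis unfolding deg_def
      by (intro sum_pos) (auto simp: in_keys_iff)
  qed
  obtain m where m: "m \<in> Poly_Mapping.keys q"
    and min: "\<And>m'. m' \<in> Poly_Mapping.keys q \<Longrightarrow> deg m \<le> deg m'"
    using ex_min_if_finite[of "deg ` Poly_Mapping.keys q"] \<open>q \<noteq> 0\<close>
    by (smt (verit, best) finite_imageI finite_keys image_iff image_is_empty keys_eq_empty not_less)
  \<comment> \<open>For \<open>a\<close> other than 0, any \<open>b\<close> with
    \<open>m = a + b\<close> has smaller degree than \<open>m\<close>, so \<open>q\<close> has no
    term there. Only \<open>a = 0\<close> survives in the convolution.\<close>
  have "Sum_any (\<lambda>b. Poly_Mapping.lookup q b when m = a + b) = 0" if "a \<noteq> 0" for a
  proof -
    have "(Poly_Mapping.lookup q b when m = a + b) = 0" for b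
    proof (cases "m = a + b")
      case True
      then have "deg b < deg m" using deg_pos[OF that] deg_add by simp
      then have "b \<notin> Poly_Mapping.keys q" using min[of b] by auto
      then show ?thesis by (simp add: in_keys_iff)
    qed simp
    then show ?thesis by simp
  qed
  then have "Poly_Mapping.lookup (p * q) m = Sum_any (\<lambda>a. Poly_Mapping.lookup p a *
      Sum_any (\<lambda>b. Poly_Mapping.lookup q b when m = a + b) when a = 0)"
    unfolding lookup_mult by (intro Sum_any.cong) (auto simp: when_def)
  also have "\<dots> = Poly_Mapping.lookup q m"
    using assms(1) by simp
  finally show False using assms(2) m by (simp add: in_keys_iff)
qed

lemma lookup_pvar_mult_0:
  "Poly_Mapping.lookup (pvar v * (q :: ('v, 'r::comm_ring_1) mpolynomial)) 0 = 0"
proof -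
  have "0 \<notin> Poly_Mapping.keys (pvar v * q)"
  proof
    assume "0 \<in> Poly_Mapping.keys (pvar v * q)"
    then obtain b where "Poly_Mapping.single v (1::nat) + b = 0"
      using keys_mult[of "pvar v" q] by (auto simp: pvar_def split: if_splits)
    then have "Poly_Mapping.lookup (Poly_Mapping.single v (1::nat) + b) v = 0" by simp
    then show False by (simp add: lookup_add)
  qed
  then show ?thesis by (simp add: in_keys_iff)
qed

text \<open>Only the empty set contributes to the constant term: in the deletion recurrence the
  second summand is a multiple of \<open>pvar v\<close>.\<close>

lemma lookup_indep_sum_0:
  assumes "finite S" "sym E" "irrefl E"
  shows "Poly_Mapping.lookup (indep_sum E pvar S :: ('v, 'r::comm_ring_1) mpolynomial) 0 = 1"
  using assms(1)
proof (induction S rule: finite_induct)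
  case (insert v S)
  then show ?case using indep_sum_delete[of "insert v S" v E "pvar :: 'v \<Rightarrow> ('v, 'r) mpolynomial"] assms
    by (simp add: lookup_add lookup_pvar_mult_0)
qed simp

lemma indep_sum_mult_cancel:
  assumes "finite S" "sym E" "irrefl E"
    and eq: "(indep_sum E pvar S :: ('v, 'r::comm_ring_1) mpolynomial) * p = indep_sum E pvar S * q"
  shows "p = q"
proof -
  have "(indep_sum E pvar S :: ('v, 'r) mpolynomial) * (p - q) = 0"
    using eq by (simp add: algebra_simps)
  then have "p - q = 0"
    using mpolynomial_const_1_cancel lookup_indep_sum_0[OF assms(1-3)] by blast
  then show ?thesis by simp
qed

section \<open>Expansions at the root clique\<close>

lemma pair_graph_parcs:
  assumes "pair_graph G"
  shows "finite (pverts G)" "parcs G \<subseteq> pverts G \<times> pverts G" "sym (parcs G)" "irrefl (parcs G)"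
  using assms unfolding pair_graph_iff sym_def irrefl_def by blast+

lemma simplicial_cliqueD: "simplicial_clique G K \<Longrightarrow> clique G K"
  by (simp add: simplicial_clique_def)

text \<open>Without its root clique the tree is a disjoint union of copies of the \<open>T u\<close>
  with no arcs between them, which gives the product. In the expansion at the root clique, choosing
  \<open>[u]\<close> removes the root clique of \<open>T u\<close> from its copy and leaves the
  other copies whole.\<close>

lemma indep_sum_clique_tree:
  fixes f :: "'v \<Rightarrow> 'r::comm_semiring_1" and G :: "'v pair_pre_digraph"
  assumes G: "pair_graph G" and K: "clique G K"
  defines "CT \<equiv> clique_tree G K"
    and "T \<equiv> \<lambda>u. clique_tree (del_verts G K) (outer_nbrs G K u)"
    and "I \<equiv> \<lambda>H. indep_sum (parcs H) (f \<circ> clique_tree_label)"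
  shows "I CT (pverts CT - root_clique K) = (\<Prod>u\<in>K. I (T u) (pverts (T u)))" (is ?minus)
    and "I CT (pverts CT) = I CT (pverts CT - root_clique K) +
      (\<Sum>u\<in>K. f u * (I (T u) (pverts (T u) - root_clique (outer_nbrs G K u)) *
        (\<Prod>v\<in>K - {u}. I (T v) (pverts (T v)))))" (is ?all)
proof -
  let ?E = "parcs CT" and ?J = "outer_nbrs G K"
  have KV: "K \<subseteq> pverts G"
    and KK: "\<And>u v. u \<in> K \<Longrightarrow> v \<in> K \<Longrightarrow> u \<noteq> v \<Longrightarrow> (u, v) \<in> parcs G"
    using K unfolding clique_def by blast+
  note fin = pair_graph_parcs(1)[OF G] and wfG = pair_graph_parcs(2)[OF G]
  have irr: "\<And>u. (u, u) \<notin> parcs G"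
    using pair_graph_parcs(4)[OF G] by (simp add: irrefl_def)
  have finK: "finite K" using fin KV finite_subset by blast
  \<comment> \<open>The base case \<open>pverts G = K\<close> also fits the recursive clause: every
    \<open>J\<^sub>u\<close> is empty there, and so is every subtree.\<close>
  have step: "pverts CT = root_clique K \<union> (\<Union>u\<in>K. (#) u ` pverts (T u))"
    "?E = {([u], [v]) | u v. u \<in> K \<and> v \<in> K \<and> u \<noteq> v} \<union>
      (\<Union>u\<in>K. {(u # p, u # q) | p q. (p, q) \<in> parcs (T u)}) \<union>
      (\<Union>u\<in>K. \<Union>r \<in> root_clique (?J u). {([u], u # r), (u # r, [u])})"
  proof -
    show "pverts CT = root_clique K \<union> (\<Union>u\<in>K. (#) u ` pverts (T u))"
    proof (cases "pverts G = K")
      case True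
      then have "pverts (T u) = {}" for u
        by (simp add: T_def clique_tree_self del_verts_def outer_nbrs_def root_clique_def)
      with True show ?thesis by (simp add: CT_def clique_tree_self)
    qed (simp add: CT_def T_def clique_tree_step fin KV)
    show "?E = {([u], [v]) | u v. u \<in> K \<and> v \<in> K \<and> u \<noteq> v} \<union>
      (\<Union>u\<in>K. {(u # p, u # q) | p q. (p, q) \<in> parcs (T u)}) \<union>
      (\<Union>u\<in>K. \<Union>r \<in> root_clique (?J u). {([u], u # r), (u # r, [u])})"
    proof (cases "pverts G = K")
      case True
      have no: "(a, b) \<notin> parcs (del_verts G K)" for a b
        using True wfG by (auto simp: del_verts_def)
      then have "parcs (T u) = {}" for u
        using True by (simp add: T_def clique_tree_self del_verts_def outer_nbrs_def)
      moreover have "root_clique (?J u) = {}" for u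
        using True by (simp add: outer_nbrs_def root_clique_def)
      moreover have "{([u], [v]) | u v. (u, v) \<in> parcs G} =
          {([u], [v]) | u v. u \<in> K \<and> v \<in> K \<and> u \<noteq> v}"
        using True wfG KK irr by blast
      ultimately show ?thesis using True by (simp add: CT_def clique_tree_self)
    qed (simp add: CT_def T_def clique_tree_step fin KV)
  qed
  have wf: "pair_graph CT" "pair_graph (T u)" "[] \<notin> pverts (T u)" for u
    using clique_tree_wf[OF G KV] clique_tree_wf[OF pair_graph_del_verts[OF G] outer_nbrs_subset]
    by (auto simp: CT_def T_def)
  note E = pair_graph_parcs(3,4)[OF wf(1)]
  have finT: "finite (pverts CT)" "finite (pverts (T u))" for u
    using wf(1,2) by (auto intro: pair_graph_parcs(1))
  \<comment> \<open>Since \<open>p\<close> is nonempty, \<open>u # p\<close> keeps the label of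
    \<open>p\<close> and is never the root vertex \<open>[u]\<close>, so the only arcs inside the
    copy are those of \<open>T u\<close>.\<close>
  have copy: "I CT ((#) u ` S) = I (T u) S" if "u \<in> K" "S \<subseteq> pverts (T u)" for u S
  proof -
    have ne: "p \<noteq> []" if "p \<in> S" for p using that \<open>S \<subseteq> _\<close> wf(3) by auto
    have "I CT ((#) u ` S) =
        indep_sum {(p, q). (u # p, u # q) \<in> ?E} ((f \<circ> clique_tree_label) \<circ> (#) u) S"
      unfolding I_def by (rule indep_sum_image) simp
    also have "\<dots> = I (T u) S"
      unfolding I_def
    proof (rule indep_sum_cong)
      show "{(p, q). (u # p, u # q) \<in> ?E} \<inter> S \<times> S = parcs (T u) \<inter> S \<times> S"
        using ne that unfolding step by auto
    qed (use ne in auto)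
    finally show ?thesis .
  qed
  have copies: "I CT (\<Union>u\<in>K. (#) u ` S u) = (\<Prod>u\<in>K. I (T u) (S u))"
    if S: "\<And>u. u \<in> K \<Longrightarrow> S u \<subseteq> pverts (T u)" for S
  proof -
    have "I CT (\<Union>u\<in>K. (#) u ` S u) = (\<Prod>u\<in>K. I CT ((#) u ` S u))"
      unfolding I_def
    proof (rule indep_sum_UN_disjoint[OF finK _ E])
      fix u v assume uv: "u \<in> K" "v \<in> K" "u \<noteq> v"
      \<comment> \<open>Arcs between lists with different heads join only root vertices, that is,
        lists of length one.\<close>
      have "(u # p, v # q) \<notin> ?E" if "p \<in> S u" "q \<in> S v" for p q
      proof -
        have "p \<noteq> []" "q \<noteq> []" using that S wf(3) uv by blast+
        then show ?thesis using uv(3) unfolding step by auto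
      qed
      with uv show "(#) u ` S u \<inter> (#) v ` S v = {} \<and> (#) u ` S u \<times> (#) v ` S v \<inter> ?E = {}"
        by auto
    qed (use S finT(2) finite_subset in blast)
    also have "\<dots> = (\<Prod>u\<in>K. I (T u) (S u))"
      using S by (intro prod.cong copy) auto
    finally show ?thesis .
  qed
  have minus: "pverts CT - root_clique K = (\<Union>u\<in>K. (#) u ` pverts (T u))"
    using wf(3) unfolding step(1) by (auto simp: root_clique_def)
  show ?minus unfolding minus by (rule copies) simp
  have nbr: "([u], v # q) \<in> ?E \<longleftrightarrow> v = u \<and> q \<in> root_clique (?J u)"
    if "u \<in> K" "q \<in> pverts (T v)" for u v q
  proof -
    have "q \<noteq> []" "[] \<notin> pverts (T u)" using that wf(3) by auto
    moreover have "([], q) \<notin> parcs (T u)"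
      using \<open>[] \<notin> pverts (T u)\<close> pair_graph_parcs(2)[OF wf(2)] by blast
    ultimately show ?thesis using that(1) unfolding step(2)
      by (auto simp: root_clique_def)
  qed
  have minus_nbrs: "I CT (pverts CT - root_clique K - ?E `` {[u]}) =
      I (T u) (pverts (T u) - root_clique (?J u)) * (\<Prod>v\<in>K - {u}. I (T v) (pverts (T v)))"
    if u: "u \<in> K" for u
  proof -
    \<comment> \<open>What remains of each copy once \<open>[u]\<close> has been chosen.\<close>
    let ?S = "\<lambda>v. if v = u then pverts (T u) - root_clique (?J u) else pverts (T v)"
    have "pverts CT - root_clique K - ?E `` {[u]} = (\<Union>v\<in>K. (#) v ` ?S v)"
    proof (rule set_eqI)
      fix r
      show "r \<in> pverts CT - root_clique K - ?E `` {[u]} \<longleftrightarrow> r \<in> (\<Union>v\<in>K. (#) v ` ?S v)"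
      proof (cases r)
        case (Cons v q)
        have "v # q \<in> (\<Union>v\<in>K. (#) v ` S v) \<longleftrightarrow> v \<in> K \<and> q \<in> S v" for S by auto
        then show ?thesis unfolding minus Cons using nbr[OF u, of q v] by auto
      qed (auto simp: minus)
    qed
    then have "I CT (pverts CT - root_clique K - ?E `` {[u]}) = (\<Prod>v\<in>K. I (T v) (?S v))"
      using copies[of ?S] by auto
    also have "\<dots> = I (T u) (?S u) * (\<Prod>v\<in>K - {u}. I (T v) (?S v))"
      using finK u by (rule prod.remove)
    finally show ?thesis by simp
  qed
  have "I CT (pverts CT) = I CT (pverts CT - root_clique K) +
      (\<Sum>r\<in>root_clique K. (f \<circ> clique_tree_label) r * I CT (pverts CT - root_clique K - ?E `` {r}))"
    unfolding I_def using finT(1) _ E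
  proof (rule indep_sum_clique)
    show "(r, s) \<in> ?E" if "r \<in> root_clique K" "s \<in> root_clique K" "r \<noteq> s" for r s
      using that unfolding step(2) by (auto simp: root_clique_def)
  qed (simp add: step(1))
  also have "(\<Sum>r\<in>root_clique K. (f \<circ> clique_tree_label) r * I CT (pverts CT - root_clique K - ?E `` {r})) =
      (\<Sum>u\<in>K. f u * I CT (pverts CT - root_clique K - ?E `` {[u]}))"
    unfolding root_clique_def[of K] by (subst sum.reindex) (auto simp: inj_on_def)
  finally show ?all by (simp add: minus_nbrs)
qed

text \<open>The counterpart for \<open>G\<close> of the tree expansion: outside \<open>K\<close>,
  the neighbours of \<open>u\<close> in \<open>K\<close> form exactly
  \<open>J\<^sub>u\<close>.\<close>

lemma indep_sum_clique_outer_nbrs: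
  assumes G: "pair_graph G" and K: "clique G K"
  shows "indep_sum (parcs G) f (pverts G) = indep_sum (parcs G) f (pverts G - K) +
    (\<Sum>u\<in>K. f u * indep_sum (parcs G) f (pverts G - K - outer_nbrs G K u))"
proof -
  have "pverts G - K - parcs G `` {u} = pverts G - K - outer_nbrs G K u" if "u \<in> K" for u
    using that by (auto simp: outer_nbrs_def nbrs_def)
  moreover have "indep_sum (parcs G) f (pverts G) = indep_sum (parcs G) f (pverts G - K) +
      (\<Sum>u\<in>K. f u * indep_sum (parcs G) f (pverts G - K - parcs G `` {u}))"
    using pair_graph_parcs[OF G] K by (intro indep_sum_clique) (auto simp: clique_def)
  ultimately show ?thesis by simp
qed

text \<open>Turns induction hypotheses about \<open>del_verts G K\<close> into statements with the
  arcs of \<open>G\<close>, as only arcs inside \<open>S\<close> matter.\<close>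

lemma indep_sum_del_verts:
  assumes "S \<inter> K = {}"
  shows "indep_sum (parcs (del_verts G K)) f S = indep_sum (parcs G) f S"
  using assms by (intro indep_sum_cong) (auto simp: del_verts_def)

section \<open>Ratio identity by induction on the number of vertices\<close>

lemma card_del_verts_less:
  assumes "finite (pverts G)" "K \<subseteq> pverts G" "u \<in> K"
  shows "card (pverts (del_verts G K)) < card (pverts G)"
  using assms by (auto simp: del_verts_def intro!: psubset_card_mono)

text \<open>
  Writing \<open>T\<close> for the tree, this is the identity \<open>I(G) / I(G - K) = I(T) / I(T - K)\<close>, cleared of
  denominators so that its induction needs no cancellation.
\<close>

lemma clique_tree_ratio:
  fixes f :: "'v \<Rightarrow> 'r::comm_semiring_1" and G :: "'v pair_pre_digraph"
  assumes "pair_graph G" "claw_free G" "simplicial_clique G K"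
  defines "CT \<equiv> clique_tree G K"
  defines "I \<equiv> indep_sum (parcs CT) (f \<circ> clique_tree_label)"
  shows "I (pverts CT) * indep_sum (parcs G) f (pverts G - K) =
    I (pverts CT - root_clique K) * indep_sum (parcs G) f (pverts G)"
  using assms(1-3) unfolding I_def CT_def
proof (induction "card (pverts G)" arbitrary: G K rule: less_induct)
  case less
  let ?H = "del_verts G K" and ?J = "outer_nbrs G K" and ?i = "indep_sum (parcs G) f"
  let ?I = "\<lambda>H. indep_sum (parcs H) (f \<circ> clique_tree_label)"
  define T where "T u = clique_tree ?H (?J u)" for u
  define t where "t u = ?I (T u) (pverts (T u))" for u
  define t' where "t' u = ?I (T u) (pverts (T u) - root_clique (?J u))" for u
  define P where "P = (\<Prod>u\<in>K. t u)"
  note fin = pair_graph_parcs(1)[OF less.prems(1)]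
  have K: "clique G K" "K \<subseteq> pverts G"
    using simplicial_cliqueD[OF less.prems(3)] by (auto simp: clique_def)
  have finK: "finite K" using fin K finite_subset by blast
  note tree = indep_sum_clique_tree[OF less.prems(1) K(1), of f, folded T_def, folded t_def t'_def, folded P_def]
  \<comment> \<open>This is the ratio identity for \<open>G - K\<close> and
    \<open>J\<^sub>u\<close>; claw-freeness makes \<open>J\<^sub>u\<close> a simplicial clique
    there.\<close>
  have IH: "t u * ?i (pverts G - K - ?J u) = t' u * ?i (pverts G - K)" if u: "u \<in> K" for u
  proof -
    have "t u * indep_sum (parcs ?H) f (pverts ?H - ?J u) = t' u * indep_sum (parcs ?H) f (pverts ?H)"
      unfolding t_def t'_def T_def using less.prems u K fin
      by (intro less.hyps card_del_verts_less)
        (auto intro: pair_graph_del_verts claw_free_del_verts simplicial_clique_outer_nbrs)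
    then show ?thesis
      by (subst (asm) (1 2) indep_sum_del_verts) (auto simp: del_verts_def)
  qed
  \<comment> \<open>The induction hypothesis trades \<open>t' u\<close> for \<open>t u\<close>, the
    factor missing from the product over \<open>K - {u}\<close>. Each summand for the tree thus
    becomes \<open>P\<close> times the summand for \<open>G\<close> at the same
    \<open>u\<close>.\<close>
  have "f u * (t' u * (\<Prod>v\<in>K - {u}. t v)) * ?i (pverts G - K) =
      P * (f u * ?i (pverts G - K - ?J u))" if "u \<in> K" for u
  proof -
    have "f u * (t' u * (\<Prod>v\<in>K - {u}. t v)) * ?i (pverts G - K) =
        f u * (\<Prod>v\<in>K - {u}. t v) * (t' u * ?i (pverts G - K))"
      by (simp add: mult_ac)
    also have "\<dots> = t u * (\<Prod>v\<in>K - {u}. t v) * (f u * ?i (pverts G - K - ?J u))"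
      unfolding IH[OF that, symmetric] by (simp add: mult_ac)
    also have "t u * (\<Prod>v\<in>K - {u}. t v) = P"
      unfolding P_def using finK that by (rule prod.remove[symmetric])
    finally show ?thesis .
  qed
  then have "(\<Sum>u\<in>K. f u * (t' u * (\<Prod>v\<in>K - {u}. t v))) * ?i (pverts G - K) =
      P * (\<Sum>u\<in>K. f u * ?i (pverts G - K - ?J u))"
    by (simp add: sum_distrib_left sum_distrib_right)
  then show ?case
    unfolding tree(2) unfolding tree(1) indep_sum_clique_outer_nbrs[OF less.prems(1) K(1), of f]
    by (simp add: distrib_left distrib_right)
qed

section \<open>Divisibility for the part reachable from the root clique\<close>

text \<open>This form applies again to each \<open>J\<^sub>u\<close> in \<open>G - K\<close>, even
  an empty one: then the reachable set and the tree are both empty, and both sums are 1.\<close>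

lemma indep_sum_reachable_dvd:
  fixes G :: "'v pair_pre_digraph"
  assumes "pair_graph G" "claw_free G" "simplicial_clique G K"
  defines "CT \<equiv> clique_tree G K"
  shows "(indep_sum (parcs G) pvar ((parcs G)\<^sup>* `` K) :: ('v, 'r::comm_ring_1) mpolynomial) dvd
    indep_sum (parcs CT) (pvar \<circ> clique_tree_label) (pverts CT)"
  using assms(1-3) unfolding CT_def
proof (induction "card (pverts G)" arbitrary: G K rule: less_induct)
  case less
  let ?H = "del_verts G K" and ?J = "outer_nbrs G K" and ?V = "pverts G" and ?E = "parcs G"
  let ?i = "indep_sum ?E pvar :: 'v set \<Rightarrow> ('v, 'r) mpolynomial"
  let ?I = "\<lambda>H. indep_sum (parcs H) (pvar \<circ> clique_tree_label) :: 'v list set \<Rightarrow> ('v, 'r) mpolynomial"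
  let ?CT = "clique_tree G K"
  define T where "T u = clique_tree ?H (?J u)" for u
  define t where "t u = ?I (T u) (pverts (T u))" for u
  define R where "R u = (parcs ?H)\<^sup>* `` ?J u" for u
  define A where "A = (\<Union>u\<in>K. R u)"
  \<comment> \<open>The vertices not reached from \<open>K\<close>. They contribute the same factor
    to \<open>I(G)\<close> and \<open>I(G - K)\<close>, which disappears in the final
    cancellation.\<close>
  define B where "B = ?V - K - A"
  note fin = pair_graph_parcs(1)[OF less.prems(1)] and wf = pair_graph_parcs(2)[OF less.prems(1)]
    and E = pair_graph_parcs(3,4)[OF less.prems(1)]
  have K: "clique G K" "K \<subseteq> ?V"
    using simplicial_cliqueD[OF less.prems(3)] by (auto simp: clique_def)
  have finK: "finite K" using fin K finite_subset by blast
  have HE: "(x, y) \<in> parcs ?H \<longleftrightarrow> (x, y) \<in> ?E \<and> x \<notin> K \<and> y \<notin> K" for x y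
    by (auto simp: del_verts_def)
  have HE_sub: "parcs ?H \<subseteq> ?E" by (auto simp: HE)
  have symH: "sym (parcs ?H)" using E(1) by (auto simp: sym_def HE)
  have RV: "R u \<subseteq> ?V - K" for u
  proof -
    have "y \<in> ?V - K" if "(x, y) \<in> (parcs ?H)\<^sup>*" "x \<in> ?V - K" for x y
      using that by (induction rule: rtrancl_induct) (use wf in \<open>auto simp: HE\<close>)
    then show ?thesis by (auto simp: R_def outer_nbrs_def)
  qed
  have R_step: "y \<in> R u" if "x \<in> R u" "(x, y) \<in> ?E" "y \<notin> K" for x y u
  proof -
    have "(x, y) \<in> parcs ?H" using that RV[of u] by (auto simp: HE)
    then show ?thesis using that(1) by (auto simp: R_def intro: rtrancl_into_rtrancl)
  qed
  have J_R: "?J u \<subseteq> R u" for u by (auto simp: R_def)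
  have A_step: "y \<in> A" if "x \<in> K \<union> A" "(x, y) \<in> ?E" "y \<notin> K" for x y
  proof (cases "x \<in> K")
    case True
    then have "y \<in> ?J x" using that wf by (auto simp: outer_nbrs_def nbrs_def)
    then show ?thesis using True J_R by (auto simp: A_def)
  next
    case False
    then show ?thesis using that R_step by (auto simp: A_def)
  qed
  \<comment> \<open>Used in both directions, this makes \<open>R u\<close> and \<open>R v\<close>
    equal or disjoint. A common vertex \<open>x\<close> links some \<open>b\<close> in
    \<open>J\<^sub>v\<close> to some \<open>a\<close> in \<open>J\<^sub>u\<close> by symmetry, and
    from \<open>a\<close> all of the clique \<open>J\<^sub>u\<close> is reached inside
    \<open>G - K\<close>.\<close>
  have R_sub: "R u \<subseteq> R v" if uv: "u \<in> K" and x: "x \<in> R u" "x \<in> R v" for u v x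
  proof -
    obtain a where a: "a \<in> ?J u" "(a, x) \<in> (parcs ?H)\<^sup>*" using x by (auto simp: R_def)
    obtain b where b: "b \<in> ?J v" "(b, x) \<in> (parcs ?H)\<^sup>*" using x by (auto simp: R_def)
    have ba: "(b, a) \<in> (parcs ?H)\<^sup>*"
      using a b sym_rtrancl[OF symH] by (blast dest: symD intro: rtrancl_trans)
    have "(b, a') \<in> (parcs ?H)\<^sup>*" if "a' \<in> ?J u" for a'
    proof (cases "a' = a")
      case False
      then have "(a, a') \<in> parcs ?H"
        using less.prems(3) uv a that
        by (auto simp: HE simplicial_clique_def clique_def) (auto simp: outer_nbrs_def)
      then show ?thesis using ba by (rule rtrancl_into_rtrancl[rotated])
    qed (use ba in simp)
    then show ?thesis unfolding R_def using b(1) by (blast intro: rtrancl_trans)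
  qed
  have reach: "?E\<^sup>* `` K = K \<union> A"
  proof (intro equalityI subsetI)
    fix y assume "y \<in> ?E\<^sup>* `` K"
    then obtain x where "(x, y) \<in> ?E\<^sup>*" "x \<in> K" by auto
    then show "y \<in> K \<union> A"
      by (induction rule: rtrancl_induct) (use A_step in auto)
  next
    fix y assume "y \<in> K \<union> A"
    then show "y \<in> ?E\<^sup>* `` K"
    proof
      assume "y \<in> A"
      then obtain u a where u: "u \<in> K" "a \<in> ?J u" "(a, y) \<in> (parcs ?H)\<^sup>*"
        by (auto simp: A_def R_def)
      have "(u, a) \<in> ?E" using u by (auto simp: outer_nbrs_def nbrs_def)
      moreover have "(a, y) \<in> ?E\<^sup>*"
        using u(3) rtrancl_mono[OF HE_sub] by blast
      ultimately show ?thesis using u(1) by (auto intro: converse_rtrancl_into_rtrancl)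
    qed auto
  qed
  have finA: "finite A" "finite B" "finite (R u)" for u
    using RV fin by (auto simp: A_def B_def finK intro: finite_subset)
  have AV: "A \<subseteq> ?V - K" using RV by (auto simp: A_def)
  have KA_B: "(K \<union> A) \<times> B \<inter> ?E = {}" "(K \<union> A) \<inter> B = {}"
    using A_step by (auto simp: B_def)
  have "?i A dvd (\<Prod>u\<in>K. t u)"
  proof -
    have dvd_t: "?i (R u) dvd t u" if u: "u \<in> K" for u
    proof -
      have "(indep_sum (parcs ?H) pvar (R u) :: ('v, 'r) mpolynomial) dvd t u"
        unfolding t_def R_def T_def using less.prems u K fin
        by (intro less.hyps card_del_verts_less)
          (auto intro: pair_graph_del_verts claw_free_del_verts simplicial_clique_outer_nbrs)
      then show ?thesis using RV[of u] by (subst (asm) indep_sum_del_verts) auto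
    qed
    \<comment> \<open>Indexing by the distinct sets \<open>R u\<close> counts a component once even
      if several \<open>u\<close> lead to it.\<close>
    have "?i A = ?i (\<Union>C\<in>R ` K. C)" by (simp add: A_def)
    also have "\<dots> = (\<Prod>C\<in>R ` K. ?i C)"
    proof (rule indep_sum_UN_disjoint)
      fix C D assume CD: "C \<in> R ` K" "D \<in> R ` K" "C \<noteq> D"
      then obtain u v where uv: "u \<in> K" "v \<in> K" "C = R u" "D = R v" by auto
      have disj: "C \<inter> D = {}" using R_sub[of u _ v] R_sub[of v _ u] CD(3) uv by blast
      moreover have "(x, y) \<notin> ?E" if "x \<in> C" "y \<in> D" for x y
        using R_step[of x u y] that RV[of v] disj uv by blast
      ultimately show "C \<inter> D = {} \<and> C \<times> D \<inter> ?E = {}" by auto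
    qed (use finK finA E in auto)
    \<comment> \<open>Group the factors \<open>t u\<close> by the set \<open>R u\<close>; within
      each group a single factor already suffices for divisibility.\<close>
    also have "\<dots> dvd (\<Prod>C\<in>R ` K. \<Prod>u\<in>{u \<in> K. R u = C}. t u)"
    proof (rule prod_dvd_prod)
      fix C assume "C \<in> R ` K"
      then obtain u where u: "u \<in> K" "C = R u" by auto
      have "t u dvd (\<Prod>u\<in>{u \<in> K. R u = C}. t u)"
        using finK u by (intro dvd_prodI) auto
      then show "?i C dvd (\<Prod>u\<in>{u \<in> K. R u = C}. t u)"
        using dvd_t[OF u(1)] u(2) dvd_trans by blast
    qed
    also have "\<dots> = (\<Prod>u\<in>K. t u)" using finK by (rule prod.image_gen[symmetric])
    finally show ?thesis .
  qed
  then obtain Q where Q: "(\<Prod>u\<in>K. t u) = ?i A * Q" by (auto elim: dvdE)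
  have "?V - K = A \<union> B" "?V = (K \<union> A) \<union> B"
    using AV K by (auto simp: B_def)
  then have iV: "?i (?V - K) = ?i A * ?i B" "?i ?V = ?i (K \<union> A) * ?i B"
    using KA_B finA finK E by (auto intro!: indep_sum_Un_disjoint)
  have "?I ?CT (pverts ?CT) * ?i (?V - K) = (\<Prod>u\<in>K. t u) * ?i ?V"
    using clique_tree_ratio[OF less.prems, of "pvar :: 'v \<Rightarrow> ('v, 'r) mpolynomial"]
    unfolding indep_sum_clique_tree(1)[OF less.prems(1) K(1), of "pvar :: 'v \<Rightarrow> ('v, 'r) mpolynomial",
      folded T_def, folded t_def] .
  \<comment> \<open>The factors \<open>?i A\<close> and \<open>?i B\<close> on the right recombine
    to \<open>?i (?V - K)\<close>, which has constant term 1 and therefore cancels.\<close>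
  then have "?i (?V - K) * ?I ?CT (pverts ?CT) = ?i (?V - K) * (?i (K \<union> A) * Q)"
    unfolding Q iV by (simp add: mult_ac)
  then have "?I ?CT (pverts ?CT) = ?i (K \<union> A) * Q"
    by (rule indep_sum_mult_cancel[OF finite_Diff[OF fin] E])
  then show ?case by (simp add: reach)
qed

section \<open>Passage to the independence polynomials of a connected graph\<close>

lemma indep_poly_conv_indep_sum: "indep_poly G = indep_sum (parcs G) pvar (pverts G)"
  unfolding indep_poly_def indep_sum_def independent_set_def
  by (intro sum.cong) auto

lemma rel_indep_poly_conv_indep_sum:
  "rel_indep_poly \<phi> H = indep_sum (parcs H) (pvar \<circ> \<phi>) (pverts H)"
  unfolding rel_indep_poly_def indep_sum_def independent_set_def
  by (intro sum.cong) auto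

text \<open>Connectedness is defined by reachability in the symmetric closure. The arcs of
  \<open>G\<close> are already symmetric, so any single vertex of \<open>K\<close> reaches every
  vertex along arcs of \<open>G\<close>.\<close>

lemma connected_reachable:
  assumes G: "pair_graph G" and "connected (with_proj G)" "K \<subseteq> pverts G" "K \<noteq> {}"
  shows "(parcs G)\<^sup>* `` K = pverts G"
proof
  interpret G: pair_graph G by fact
  show "(parcs G)\<^sup>* `` K \<subseteq> pverts G"
  proof
    fix y assume "y \<in> (parcs G)\<^sup>* `` K"
    then obtain x where "(x, y) \<in> (parcs G)\<^sup>*" "x \<in> K" by auto
    then show "y \<in> pverts G"
      using assms(3) G.in_arcsD2 by (induction rule: rtrancl_induct) auto
  qed
  show "pverts G \<subseteq> (parcs G)\<^sup>* `` K"
  proof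
    fix y assume y: "y \<in> pverts G"
    obtain x where x: "x \<in> K" using assms(4) by auto
    have "x \<rightarrow>\<^sup>*\<^bsub>with_proj (mk_symmetric (with_proj G))\<^esub> y"
      using assms(2,3) x y by (auto simp: connected_def strongly_connected_def)
    then have "x \<rightarrow>\<^sup>*\<^bsub>with_proj G\<^esub> y"
      using G.reachable_mk_symmetric_eq[OF G.sym_arcs] by simp
    then have "(x, y) \<in> (parcs G)\<^sup>*"
      using G.reachable_conv by (simp add: arcs_ends_conv)
    then show "y \<in> (parcs G)\<^sup>* `` K" using x by auto
  qed
qed

theorem corollary4p8:
  fixes G :: "'v pair_pre_digraph" and K :: "'v set"
  assumes "pair_graph G"
    and "simplicial_graph G"
    and "connected (with_proj G)"
    and "simplicial_clique G K" and "K \<noteq> {}"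
  shows "(indep_poly G :: ('v, 'r::comm_ring_1) mpolynomial) dvd
    rel_indep_poly clique_tree_label (clique_tree G K)"
proof -
  have "claw_free G" "K \<subseteq> pverts G"
    using assms(2) simplicial_cliqueD[OF assms(4)] by (auto simp: simplicial_graph_def clique_def)
  then show ?thesis
    using indep_sum_reachable_dvd[OF assms(1) _ assms(4)] connected_reachable[OF assms(1,3) _ assms(5)]
    by (simp add: indep_poly_conv_indep_sum rel_indep_poly_conv_indep_sum)
qed

end
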